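(* Let $N\ge2$ and let $\mathbf Z=(Z^{(1)},\dots,Z^{(N)})\ge\mathbf 0$ be a multivariate regularly varying random vector with scaling function $b(\cdot)$ and angular measure $\mathbb S$. Let $A_1,A_2\subset\{1,\dots,N\}$ with $A_1\cap A_2=\emptyset$, $\#A_1=N_1\ge1$, $\#A_2=N_2\ge1$, and write $\mathbf Z_{A_j}=(Z^{(i)})_{i\in A_j}$, $j=1,2$. The following are equivalent: 0) $\mathbf Z_{A_1}$ is asymptotically independent of $\mathbf Z_{A_2}$, i.e. $$\lim_{t\to\infty}t\,\mathbb P\Big(\frac{\mathbf Z_{A_1}}{b(t)}\in B_1,\frac{\mathbf Z_{A_2}}{b(t)}\in B_2\Big)=0$$ for all Borel $B_1\subset\mathbb R^{N_1}$, $B_2\subset\mathbb R^{N_2}$ with $d(B_i,\mathbf 0)>0$, $i=1,2$. 1) For all Borel sets $B_1,B_2\subset\mathbb R^N$ bounded away from $\mathbf 0$ of the form $B_1=B_1^{(1)}\times\cdots\times B_1^{(N)}$ with $B_1^{(i)}=\mathbb R$ for all $i\in A_2$, and $B_2=B_2^{(1)}\times\cdots\times B_2^{(N)}$ with $B_2^{(i)}=\mathbb R$ for all $i\in A_1$, $$t\,\mathbb P\Big(\frac{\mathbf Z}{b(t)}\in B_1\cap B_2\Big)\to0,\qquad t\to\infty.$$ 2) For all $i\in A_1$, $j\in A_2$ and $c>0$, $$t\,\mathbb P\Big(\frac{Z^{(i)}}{b(t)}>c,\ \frac{Z^{(j)}}{b(t)}>c\Big)\to0,\qquad t\to\infty.$$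 3) The angular measure concentrates on the faces corresponding to $A_1$ and $A_2$: $$\mathbb S(C^N(A_1))+\mathbb S(C^N(A_2))=1.$$
   Context: Notation. $\|\mathbf x\|=\sum_i|x^{(i)}|$ is the $L_1$-norm, $d$ is Euclidean distance, $C^N=\{\mathbf z\in\mathbb R^N:\|\mathbf z\|=1\}$. For $A\subset\{1,\dots,N\}$ the face is $C^N(A)=\{\mathbf z\in C^N: z^{(i)}=0\text{ when } i\notin A\}$. $\#A$ is the number of elements of a finite set $A$. Multivariate regular variation. A random vector $\mathbf Z$ in $\mathbb R^N$ is (standard) multivariate regularly varying with scaling function $b$ if $b(t)\uparrow\infty$ as $t\to\infty$ and there is a Radon measure $\nu$ on $\mathbb E=[-\infty,\infty]^N\setminus\{\mathbf 0\}$ with $t\,\mathbb P(\mathbf Z/b(t)\in\cdot)\to\nu$ vaguely in $M_+(\mathbb E)$ (the non-negative Radon measures on $\mathbb E$); equivalently, $t\,\mathbb P\big((\|\mathbf Z\|/b(t),\mathbf Z/\|\mathbf Z\|)\in\cdot\big)\to c\,\nu_\alpha\times\mathbb S$ vaguely in $M_+((0,\infty]\times C^N)$, where $c>0$, $\alpha>0$, $\nu_\alpha((x,\infty])=x^{-\alpha}$ and $\mathbb S$ is a probability measure on $C^N$, called the angular measure.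
   Formalization: The full equivalence is proved when A_1 ∪ A_2 = {1,…,N}; as stated it fails otherwise (N=3, Z=(0,0,X), A_1={1}, A_2={2}). For general disjoint A_1, A_2 the theorem gives 0)⇔2), 1)⇔3) and 1)⇒0). *)

theory Defs
  imports "HOL-Probability.Probability"
begin

section \<open>Vague convergence\<close>

text \<open>
  Measures on a subspace \<open>E\<close> are measures on the trace of the Borel sets on \<open>E\<close>. The spaces used
  below are locally compact with a countable base, so a Radon measure is a Borel measure that is
  finite on compact sets.
\<close>

definition radon_on :: "'a::topological_space set \<Rightarrow> 'a measure \<Rightarrow> bool" where
  "radon_on E \<nu> \<longleftrightarrow>
     sets \<nu> = sets (restrict_space borel E) \<and>
     (\<forall>K. compact K \<and> K \<subseteq> E \<longrightarrow> emeasure \<nu> K < \<infinity>)"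

definition vaguely_tendsto ::
  "'a::topological_space set \<Rightarrow> (real \<Rightarrow> 'a measure) \<Rightarrow> 'a measure \<Rightarrow> bool" where
  "vaguely_tendsto E \<mu> \<nu> \<longleftrightarrow>
     (\<forall>f :: 'a \<Rightarrow> real.
        continuous_on E f \<and> (\<forall>x\<in>E. 0 \<le> f x) \<and>
        (\<exists>K. compact K \<and> K \<subseteq> E \<and> (\<forall>x\<in>E - K. f x = 0)) \<longrightarrow>
        ((\<lambda>t. integral\<^sup>L (\<mu> t) f) \<longlongrightarrow> integral\<^sup>L \<nu> f) at_top)"

section \<open>Multivariate regular variation\<close>

definition l1_norm :: "real ^ 'n::finite \<Rightarrow> real" where
  "l1_norm x = (\<Sum>i\<in>UNIV. \<bar>x $ i\<bar>)"

definition l1_sphere :: "(real ^ 'n::finite) set" where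
  "l1_sphere = {z. l1_norm z = 1}"

definition face :: "'n::finite set \<Rightarrow> (real ^ 'n) set" where
  "face A = {z \<in> l1_sphere. \<forall>i. i \<notin> A \<longrightarrow> z $ i = 0}"

definition punctured_space :: "(ereal ^ 'n::finite) set" where
  "punctured_space = UNIV - {0}"

definition polar_space :: "(ereal \<times> (real ^ 'n::finite)) set" where
  "polar_space = {0<..} \<times> l1_sphere"

text \<open>The measures \<open>t P(Z / b(t) \<in> \<cdot>)\<close> on \<open>[-\<infinity>, \<infinity>]\<^sup>N \<setminus> {0}\<close>.\<close>

definition scaled_law ::
  "'a measure \<Rightarrow> ('a \<Rightarrow> real ^ 'n::finite) \<Rightarrow> (real \<Rightarrow> real) \<Rightarrow> real \<Rightarrow> (ereal ^ 'n) measure" where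
  "scaled_law M Z b t =
     scale_measure (ennreal t)
       (restrict_space (distr M borel (\<lambda>\<omega>. \<chi> i. ereal (Z \<omega> $ i / b t))) punctured_space)"

text \<open>
  The measures \<open>t P((\<parallel>Z\<parallel> / b(t), Z / \<parallel>Z\<parallel>) \<in> \<cdot>)\<close> on \<open>(0, \<infinity>] \<times> C\<^sup>N\<close>. On \<open>Z = 0\<close> the pair is \<open>(0, 0)\<close>,
  which lies outside \<open>polar_space\<close> and is discarded by the restriction.
\<close>

definition scaled_polar_law ::
  "'a measure \<Rightarrow> ('a \<Rightarrow> real ^ 'n::finite) \<Rightarrow> (real \<Rightarrow> real) \<Rightarrow> real
     \<Rightarrow> (ereal \<times> (real ^ 'n)) measure" where
  "scaled_polar_law M Z b t =
     scale_measure (ennreal t)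
       (restrict_space
          (distr M borel (\<lambda>\<omega>. (ereal (l1_norm (Z \<omega>) / b t), Z \<omega> /\<^sub>R l1_norm (Z \<omega>))))
          polar_space)"

text \<open>\<open>\<nu>\<^sub>\<alpha>\<close> on \<open>(0, \<infinity>]\<close>; the tail condition determines it uniquely and gives \<open>\<infinity>\<close> mass zero.\<close>

definition power_tail_measure :: "real \<Rightarrow> ereal measure \<Rightarrow> bool" where
  "power_tail_measure \<alpha> \<nu> \<longleftrightarrow>
     sets \<nu> = sets (restrict_space borel {0<..}) \<and>
     (\<forall>x::real. 0 < x \<longrightarrow> emeasure \<nu> {ereal x<..} = ennreal (x powr (- \<alpha>)))"

definition regularly_varying ::
  "'a measure \<Rightarrow> ('a \<Rightarrow> real ^ 'n::finite) \<Rightarrow> (real \<Rightarrow> real) \<Rightarrow> bool" where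
  "regularly_varying M Z b \<longleftrightarrow>
     mono_on {0<..} b \<and> filterlim b at_top at_top \<and>
     (\<exists>\<nu>. radon_on punctured_space \<nu> \<and>
        vaguely_tendsto punctured_space (scaled_law M Z b) \<nu>)"

definition angular_measure ::
  "'a measure \<Rightarrow> ('a \<Rightarrow> real ^ 'n::finite) \<Rightarrow> (real \<Rightarrow> real) \<Rightarrow> (real ^ 'n) measure \<Rightarrow> bool" where
  "angular_measure M Z b S \<longleftrightarrow>
     prob_space S \<and> sets S = sets (restrict_space borel l1_sphere) \<and>
     (\<exists>c>0. \<exists>\<alpha>>0. \<exists>\<nu>. power_tail_measure \<alpha> \<nu> \<and>
        vaguely_tendsto polar_space (scaled_polar_law M Z b)
          (scale_measure (ennreal c) (\<nu> \<Otimes>\<^sub>M S)))"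

section \<open>The four conditions\<close>

text \<open>
  \<open>\<real>\<^sup>A\<close> is the space of \<open>\<Pi>\<^sub>M i\<in>A. borel\<close>, i.e. the extensional functions on \<open>A\<close>, with Euclidean norm
  \<open>L2_set x A\<close>. The infimum defining \<open>d(B, 0)\<close> is written out because \<open>infdist\<close> and \<open>setdist\<close> are
  \<open>0\<close> on the empty set.
\<close>

definition asymp_independent ::
  "'a measure \<Rightarrow> ('a \<Rightarrow> real ^ 'n::finite) \<Rightarrow> (real \<Rightarrow> real) \<Rightarrow> 'n set \<Rightarrow> 'n set \<Rightarrow> bool" where
  "asymp_independent M Z b A1 A2 \<longleftrightarrow>
     (\<forall>B1 \<in> sets (\<Pi>\<^sub>M i\<in>A1. (borel :: real measure)).
      \<forall>B2 \<in> sets (\<Pi>\<^sub>M i\<in>A2. (borel :: real measure)).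
        (\<exists>\<epsilon>>0. \<forall>x\<in>B1. \<epsilon> \<le> L2_set x A1) \<and> (\<exists>\<epsilon>>0. \<forall>x\<in>B2. \<epsilon> \<le> L2_set x A2) \<longrightarrow>
        ((\<lambda>t. t * measure M {\<omega> \<in> space M.
              (\<lambda>i\<in>A1. Z \<omega> $ i / b t) \<in> B1 \<and> (\<lambda>i\<in>A2. Z \<omega> $ i / b t) \<in> B2}) \<longlongrightarrow> 0) at_top)"

definition bounded_away_from_0 :: "(real ^ 'n::finite) set \<Rightarrow> bool" where
  "bounded_away_from_0 B \<longleftrightarrow> (\<exists>\<epsilon>>0. \<forall>z\<in>B. \<epsilon> \<le> dist z 0)"

definition box_free_on :: "'n::finite set \<Rightarrow> (real ^ 'n) set \<Rightarrow> bool" where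
  "box_free_on A B \<longleftrightarrow> (\<exists>F :: 'n \<Rightarrow> real set. B = {z. \<forall>i. z $ i \<in> F i} \<and> (\<forall>i\<in>A. F i = UNIV))"

definition asymp_null_on_boxes ::
  "'a measure \<Rightarrow> ('a \<Rightarrow> real ^ 'n::finite) \<Rightarrow> (real \<Rightarrow> real) \<Rightarrow> 'n set \<Rightarrow> 'n set \<Rightarrow> bool" where
  "asymp_null_on_boxes M Z b A1 A2 \<longleftrightarrow>
     (\<forall>B1 \<in> sets borel. \<forall>B2 \<in> sets borel.
        bounded_away_from_0 B1 \<and> box_free_on A2 B1 \<and>
        bounded_away_from_0 B2 \<and> box_free_on A1 B2 \<longrightarrow>
        ((\<lambda>t. t * measure M {\<omega> \<in> space M. Z \<omega> /\<^sub>R b t \<in> B1 \<inter> B2}) \<longlongrightarrow> 0) at_top)"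

definition pairwise_asymp_independent ::
  "'a measure \<Rightarrow> ('a \<Rightarrow> real ^ 'n::finite) \<Rightarrow> (real \<Rightarrow> real) \<Rightarrow> 'n set \<Rightarrow> 'n set \<Rightarrow> bool" where
  "pairwise_asymp_independent M Z b A1 A2 \<longleftrightarrow>
     (\<forall>i\<in>A1. \<forall>j\<in>A2. \<forall>c>0.
        ((\<lambda>t. t * measure M {\<omega> \<in> space M. Z \<omega> $ i / b t > c \<and> Z \<omega> $ j / b t > c}) \<longlongrightarrow> 0) at_top)"

text \<open>
  If \<open>A1 \<union> A2\<close> is not the whole index set, this condition and \<open>asymp_null_on_boxes\<close> also constrain the
  remaining coordinates, and are not implied by \<open>asymp_independent\<close> in general: for
  \<open>Z = (0, 0, X)\<close> with \<open>X\<close> regularly varying, \<open>A1 = {1}\<close>, \<open>A2 = {2}\<close>, asymptotic independence is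
  trivial, but both faces have angular measure \<open>0\<close> and the boxes \<open>B1 = B2 = {z. z $ 3 > 1}\<close> are
  not asymptotically null.
\<close>

definition concentrates_on_faces :: "(real ^ 'n::finite) measure \<Rightarrow> 'n set \<Rightarrow> 'n set \<Rightarrow> bool" where
  "concentrates_on_faces S A1 A2 \<longleftrightarrow> measure S (face A1) + measure S (face A2) = 1"

end

theory Submission
  imports Defs
begin

text \<open>
  For coordinates \<open>i\<close>, \<open>j\<close>, the event that both \<open>Z $ i / b t\<close> and \<open>Z $ j / b t\<close> exceed a level is
  asymptotically null at every level iff \<open>S\<close> gives no mass to \<open>{z. z $ i > 0 \<and> z $ j > 0}\<close>. This is
  read off the polar limit by testing with products of a cutoff in the radius and a continuous
  function of the angle. Conditions 0 and 2 concern the pairs in \<open>A1 \<times> A2\<close>, since a vector bounded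
  away from \<open>0\<close> has a large coordinate. Conditions 1 and 3 concern the pairs in \<open>- A2 \<times> - A1\<close>: a
  point of the sphere is off both faces iff some coordinate outside \<open>A2\<close> and some coordinate outside
  \<open>A1\<close> are nonzero. If \<open>A1\<close> and \<open>A2\<close> cover all indices, these are the same pairs.
\<close>

section \<open>The L1 norm, its unit sphere, and normalization of nonzero vectors\<close>

lemma l1_norm_nonneg: "0 \<le> l1_norm x"
  unfolding l1_norm_def by (rule sum_nonneg) simp

lemma norm_le_l1_norm: "norm x \<le> l1_norm x"
  unfolding l1_norm_def by (rule norm_le_l1_cart)

lemma component_le_l1_norm: "\<bar>x $ i\<bar> \<le> l1_norm x"
  unfolding l1_norm_def by (rule member_le_sum) auto

lemma continuous_on_l1_norm: "continuous_on A l1_norm"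
  unfolding l1_norm_def[abs_def] by (intro continuous_intros)

lemma borel_measurable_l1_norm [measurable]: "l1_norm \<in> borel_measurable borel"
  by (rule borel_measurable_continuous_onI) (rule continuous_on_l1_norm)

lemma compact_l1_sphere: "compact (l1_sphere :: (real ^ 'n::finite) set)"
proof -
  have "bounded (l1_sphere :: (real ^ 'n) set)"
    unfolding bounded_iff l1_sphere_def using norm_le_l1_norm by (metis mem_Collect_eq)
  moreover have "closed (l1_sphere :: (real ^ 'n) set)"
    unfolding l1_sphere_def by (intro closed_Collect_eq continuous_on_l1_norm continuous_on_const)
  ultimately show ?thesis by (simp add: compact_eq_bounded_closed)
qed

lemma l1_norm_normalized:
  assumes "x \<noteq> 0"
  shows "0 < l1_norm x" and "x /\<^sub>R l1_norm x \<in> l1_sphere"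
proof -
  show *: "0 < l1_norm x" using assms norm_le_l1_norm[of x] by (meson less_le_trans zero_less_norm_iff)
  have "l1_norm (x /\<^sub>R l1_norm x) = l1_norm x / l1_norm x"
    unfolding l1_norm_def
    by (simp add: abs_mult sum_distrib_right[symmetric] divide_inverse sum_nonneg mult.commute[of "inverse _"])
  then show "x /\<^sub>R l1_norm x \<in> l1_sphere" using * by (simp add: l1_sphere_def)
qed

lemma polar_space_borel: "polar_space \<in> sets (borel :: (ereal \<times> (real ^ 'n::finite)) measure)"
proof -
  have "(l1_sphere :: (real ^ 'n) set) \<in> sets borel"
    by (rule borel_closed[OF compact_imp_closed[OF compact_l1_sphere]])
  then show ?thesis unfolding polar_space_def borel_prod[symmetric] by (intro pair_measureI) auto
qed

section \<open>Integrals against scaled measures and product measures\<close>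

text \<open>Passing to the nonnegative integral covers divergent integrals as well:
  \<open>enn2real\<close> turns infinity into \<open>0\<close> on both sides.\<close>

lemma integral_scale_measure:
  fixes f :: "'a \<Rightarrow> real"
  assumes "0 \<le> r" "f \<in> borel_measurable M" "\<And>x. 0 \<le> f x"
  shows "integral\<^sup>L (scale_measure (ennreal r) M) f = r * integral\<^sup>L M f"
proof -
  have f: "f \<in> borel_measurable (scale_measure (ennreal r) M)"
    using assms(2) by simp
  have "integral\<^sup>L (scale_measure (ennreal r) M) f
      = enn2real (\<integral>\<^sup>+x. ennreal (f x) \<partial>scale_measure (ennreal r) M)"
    by (rule integral_eq_nn_integral[OF f]) (simp add: assms)
  also have "\<dots> = enn2real (ennreal r * (\<integral>\<^sup>+x. ennreal (f x) \<partial>M))"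
    using assms by (subst nn_integral_scale_measure) auto
  also have "\<dots> = r * integral\<^sup>L M f"
    using assms by (simp add: enn2real_mult integral_eq_nn_integral)
  finally show ?thesis .
qed

text \<open>Tonelli's theorem with the inner integral over \<open>S\<close>. A nonnegative product
  factors, and multiplicativity of \<open>enn2real\<close> also covers infinite factors.\<close>

lemma integral_pair_measure_times:
  fixes g :: "'a \<Rightarrow> real" and h :: "'b \<Rightarrow> real"
  assumes "sigma_finite_measure S"
    and [measurable]: "g \<in> borel_measurable \<nu>" "h \<in> borel_measurable S"
    and "\<And>x. 0 \<le> g x" "\<And>y. 0 \<le> h y"
  shows "(\<integral>p. g (fst p) * h (snd p) \<partial>(\<nu> \<Otimes>\<^sub>M S)) = (\<integral>x. g x \<partial>\<nu>) * (\<integral>y. h y \<partial>S)"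
proof -
  interpret S: sigma_finite_measure S by fact
  have "(\<integral>p. g (fst p) * h (snd p) \<partial>(\<nu> \<Otimes>\<^sub>M S))
      = enn2real (\<integral>\<^sup>+p. ennreal (g (fst p)) * ennreal (h (snd p)) \<partial>(\<nu> \<Otimes>\<^sub>M S))"
    using assms(4,5) by (subst integral_eq_nn_integral) (auto simp: ennreal_mult)
  also have "\<dots> = enn2real (\<integral>\<^sup>+x. \<integral>\<^sup>+y. ennreal (g x) * ennreal (h y) \<partial>S \<partial>\<nu>)"
    by (subst S.nn_integral_fst[symmetric]) auto
  also have "\<dots> = enn2real ((\<integral>\<^sup>+x. ennreal (g x) \<partial>\<nu>) * (\<integral>\<^sup>+y. ennreal (h y) \<partial>S))"
    by (simp add: nn_integral_cmult nn_integral_multc)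
  also have "\<dots> = (\<integral>x. g x \<partial>\<nu>) * (\<integral>y. h y \<partial>S)"
    using assms(4,5) by (simp add: enn2real_mult integral_eq_nn_integral)
  finally show ?thesis .
qed

section \<open>The radial cutoff\<close>

text \<open>A continuous cutoff between the indicators of \<open>[2\<delta>, \<infinity>]\<close> and \<open>(\<delta>, \<infinity>]\<close>.\<close>

definition ramp :: "real \<Rightarrow> ereal \<Rightarrow> real" where
  "ramp \<delta> r = (real_of_ereal (max (ereal \<delta>) (min (ereal (2 * \<delta>)) r)) - \<delta>) / \<delta>"

lemma continuous_on_ramp: "continuous_on A (ramp \<delta>)"
proof -
  have "continuous_on A (\<lambda>r. real_of_ereal (max (ereal \<delta>) (min (ereal (2 * \<delta>)) r)))"
  \<comment> \<open>Clamping between two finite bounds keeps the argument of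
    \<open>real_of_ereal\<close> away from both infinities, where it is discontinuous.\<close>
  proof (rule continuous_on_compose2[OF continuous_on_real])
    show "continuous_on A (\<lambda>r. max (ereal \<delta>) (min (ereal (2 * \<delta>)) r))"
      by (intro continuous_intros)
    show "(\<lambda>r. max (ereal \<delta>) (min (ereal (2 * \<delta>)) r)) ` A \<subseteq> UNIV - {\<infinity>, - \<infinity>}"
      by (auto simp: max_def min_def)
  qed
  then show ?thesis unfolding ramp_def[abs_def]
    \<comment> \<open>For \<open>\<delta> = 0\<close> the division by zero makes \<open>ramp\<close>
      constantly \<open>0\<close>.\<close>
    by (cases "\<delta> = 0") (auto intro!: continuous_intros)
qed

lemma borel_measurable_ramp [measurable]: "ramp \<delta> \<in> borel_measurable borel"
  by (rule borel_measurable_continuous_onI) (rule continuous_on_ramp)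

lemma ramp_bounds:
  assumes "0 < \<delta>"
  shows "0 \<le> ramp \<delta> r" "ramp \<delta> r \<le> 1"
    and "r \<le> ereal \<delta> \<Longrightarrow> ramp \<delta> r = 0" "ereal (2 * \<delta>) \<le> r \<Longrightarrow> ramp \<delta> r = 1"
  using assms by (cases r; simp add: ramp_def max_def min_def field_simps)+

lemma borel_measurable_ramp_tail:
  assumes "power_tail_measure \<alpha> \<nu>"
  shows "ramp \<delta> \<in> borel_measurable \<nu>"
proof -
  have "sets \<nu> = sets (restrict_space borel {0<..})"
    using assms by (simp add: power_tail_measure_def)
  then show ?thesis
    using measurable_restrict_space1[OF borel_measurable_ramp]
    by (simp add: measurable_cong_sets[of \<nu> "restrict_space borel {0<..}"])
qed

text \<open>The cutoff lies between the indicators of the tails beyond \<open>2 * \<delta>\<close>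
  and beyond \<open>\<delta>\<close>, whose masses are known. The lower bound makes the radial
  factor of the limit positive; the upper bound makes large radii negligible.\<close>

lemma ramp_integral_bounds:
  assumes "power_tail_measure \<alpha> \<nu>" "0 < \<delta>"
  shows "(2 * \<delta>) powr (- \<alpha>) \<le> (\<integral>r. ramp \<delta> r \<partial>\<nu>)"
    and "(\<integral>r. ramp \<delta> r \<partial>\<nu>) \<le> \<delta> powr (- \<alpha>)"
proof -
  have sets: "sets \<nu> = sets (restrict_space borel {0<..})"
    and tail: "\<And>x::real. 0 < x \<Longrightarrow> emeasure \<nu> {ereal x<..} = ennreal (x powr (- \<alpha>))"
    using assms(1) by (auto simp: power_tail_measure_def)
  have in_sets: "{ereal x<..} \<in> sets \<nu>" if "0 < x" for x
    using that unfolding sets by (subst sets_restrict_space_iff) (auto simp: order_less_trans)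
  have ind: "integrable \<nu> (indicator {ereal x<..} :: ereal \<Rightarrow> real)"
    "(\<integral>r. indicator {ereal x<..} r \<partial>\<nu>) = x powr (- \<alpha>)" if "0 < x" for x
  proof -
    have "measure \<nu> {ereal x<..} = x powr (- \<alpha>)"
      using tail[OF that] by (simp add: measure_def)
    moreover have "{ereal x<..} \<inter> space \<nu> = {ereal x<..}"
      using sets.sets_into_space[OF in_sets[OF that]] by blast
    ultimately show "(\<integral>r. indicator {ereal x<..} r \<partial>\<nu>) = x powr (- \<alpha>)" by simp
    show "integrable \<nu> (indicator {ereal x<..} :: ereal \<Rightarrow> real)"
      using in_sets[OF that] tail[OF that] by (intro integrable_real_indicator) auto
  qed
  note [measurable] = borel_measurable_ramp_tail[OF assms(1)]
  have le: "ramp \<delta> r \<le> indicator {ereal \<delta><..} r" for r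
    using ramp_bounds[OF assms(2), of r] by (auto simp: indicator_def not_less)
  have ge: "indicator {ereal (2 * \<delta>)<..} r \<le> ramp \<delta> r" for r
    using ramp_bounds[OF assms(2), of r] by (auto simp: indicator_def)
  have int: "integrable \<nu> (ramp \<delta>)"
    by (rule Bochner_Integration.integrable_bound[OF ind(1)[OF assms(2)]])
      (use le ramp_bounds(1)[OF assms(2)] in auto)
  show "(2 * \<delta>) powr (- \<alpha>) \<le> (\<integral>r. ramp \<delta> r \<partial>\<nu>)"
    using integral_mono[OF ind(1) int ge] ind(2) assms(2) by simp
  show "(\<integral>r. ramp \<delta> r \<partial>\<nu>) \<le> \<delta> powr (- \<alpha>)"
    using integral_mono[OF int ind(1) le] ind(2) assms(2) by simp
qed

section \<open>Consequences of convergence in polar coordinates\<close>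

text \<open>Fixes the witnesses \<open>c\<close>, \<open>\<alpha>\<close> and \<open>\<nu>\<close>
  hidden in \<open>angular_measure\<close>, so that all limits below refer to the same product
  measure.\<close>

locale polar_convergence = prob_space M + S: prob_space S
  for M :: "'a measure" and S :: "(real ^ 'n::finite) measure" +
  fixes Z :: "'a \<Rightarrow> real ^ 'n" and b :: "real \<Rightarrow> real"
    and c \<alpha> :: real and \<nu> :: "ereal measure"
  assumes Z_measurable [measurable]: "Z \<in> borel_measurable M"
    and Z_nonneg: "AE \<omega> in M. \<forall>i. 0 \<le> Z \<omega> $ i"
    and b_at_top: "filterlim b at_top at_top"
    and sets_S: "sets S = sets (restrict_space borel l1_sphere)"
    and c_pos: "0 < c" and \<alpha>_pos: "0 < \<alpha>"
    and tail: "power_tail_measure \<alpha> \<nu>"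
    and vague: "vaguely_tendsto polar_space (scaled_polar_law M Z b)
      (scale_measure (ennreal c) (\<nu> \<Otimes>\<^sub>M S))"
begin

lemma space_S: "space S = l1_sphere"
  using sets_eq_imp_space_eq[OF sets_S] by (simp add: space_restrict_space)

lemma borel_measurable_S: "h \<in> borel_measurable borel \<Longrightarrow> h \<in> borel_measurable S"
  using measurable_restrict_space1 by (simp add: measurable_cong_sets[OF sets_S refl])

text \<open>Estimates that multiply or divide by \<open>b t\<close> are made only where both
  \<open>t\<close> and \<open>b t\<close> are positive.\<close>

lemma eventually_b_pos: "eventually (\<lambda>t. 0 < t \<and> 0 < b t) at_top"
  using b_at_top by (intro eventually_conj eventually_gt_at_top) (simp add: filterlim_at_top_dense)

text \<open>For \<open>t\<close> and \<open>b t\<close> positive, this is the integral of the test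
  function \<open>ramp \<delta> r * h z\<close> against \<open>scaled_polar_law\<close>, pulled back
  to \<open>M\<close>. Where \<open>Z \<omega> = 0\<close> the angle is the junk value
  \<open>0\<close>, but for positive \<open>\<delta>\<close> the ramp vanishes there.\<close>

definition polar_mean :: "real \<Rightarrow> (real ^ 'n \<Rightarrow> real) \<Rightarrow> real \<Rightarrow> real" where
  "polar_mean \<delta> h t =
     t * (\<integral>\<omega>. ramp \<delta> (ereal (l1_norm (Z \<omega>) / b t)) * h (Z \<omega> /\<^sub>R l1_norm (Z \<omega>)) \<partial>M)"

text \<open>Cutoff times angular function is an admissible test function for vague convergence, and
  its integral against the product limit factors.\<close>

lemma polar_mean_tendsto:
  assumes \<delta>: "0 < \<delta>" and h: "continuous_on UNIV h" "\<And>z. 0 \<le> h z"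
  shows "(polar_mean \<delta> h \<longlongrightarrow> c * (\<integral>r. ramp \<delta> r \<partial>\<nu>) * (\<integral>z. h z \<partial>S)) at_top"
proof -
  define f where "f = (\<lambda>p. ramp \<delta> (fst p) * h (snd p))"
  have hm [measurable]: "h \<in> borel_measurable borel"
    using h(1) by (rule borel_measurable_continuous_onI)
  have f_cont: "continuous_on A f" for A
    unfolding f_def
    by (intro continuous_on_mult continuous_on_compose2[OF continuous_on_ramp[of UNIV]]
        continuous_on_compose2[OF h(1)] continuous_on_fst continuous_on_snd continuous_on_id) auto
  have fm: "f \<in> borel_measurable borel"
    by (rule borel_measurable_continuous_onI) (rule f_cont)
  have f_nonneg: "0 \<le> f p" for p
    unfolding f_def using ramp_bounds(1)[OF \<delta>] h(2) by simp
  \<comment> \<open>The radial part is compact because it contains infinity, and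
    \<open>0 < \<delta>\<close> keeps it inside \<open>polar_space\<close>.\<close>
  define K :: "(ereal \<times> (real ^ 'n)) set" where "K = {ereal \<delta>..} \<times> l1_sphere"
  have "compact {ereal \<delta>..}"
    using closed_Int_compact[OF closed_atLeast[of "ereal \<delta>"] compact_UNIV] by simp
  then have K: "compact K"
    unfolding K_def by (intro compact_Times compact_l1_sphere)
  have "K \<subseteq> polar_space" unfolding K_def polar_space_def using \<delta>
    by (auto intro: less_le_trans[of 0 "ereal \<delta>"])
  moreover have "\<forall>p\<in>polar_space - K. f p = 0"
    unfolding K_def polar_space_def f_def using ramp_bounds(3)[OF \<delta>] by (auto, meson linear)
  ultimately have lim: "((\<lambda>t. integral\<^sup>L (scaled_polar_law M Z b t) f)
      \<longlongrightarrow> integral\<^sup>L (scale_measure (ennreal c) (\<nu> \<Otimes>\<^sub>M S)) f) at_top"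
    using vague f_cont f_nonneg K unfolding vaguely_tendsto_def by blast
  note g\<nu> = borel_measurable_ramp_tail[OF tail] and hS = borel_measurable_S[OF hm]
  have "f \<in> borel_measurable (\<nu> \<Otimes>\<^sub>M S)"
    unfolding f_def using g\<nu> hS by measurable
  then have "integral\<^sup>L (scale_measure (ennreal c) (\<nu> \<Otimes>\<^sub>M S)) f = c * integral\<^sup>L (\<nu> \<Otimes>\<^sub>M S) f"
    using c_pos f_nonneg by (intro integral_scale_measure) auto
  also have "integral\<^sup>L (\<nu> \<Otimes>\<^sub>M S) f = (\<integral>r. ramp \<delta> r \<partial>\<nu>) * (\<integral>z. h z \<partial>S)"
    unfolding f_def using g\<nu> hS ramp_bounds(1)[OF \<delta>] h(2)
    by (intro integral_pair_measure_times S.sigma_finite_measure_axioms) auto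
  finally have R: "integral\<^sup>L (scale_measure (ennreal c) (\<nu> \<Otimes>\<^sub>M S)) f
      = c * (\<integral>r. ramp \<delta> r \<partial>\<nu>) * (\<integral>z. h z \<partial>S)" by simp
  have L: "integral\<^sup>L (scaled_polar_law M Z b t) f = polar_mean \<delta> h t"
    if t: "0 < t" "0 < b t" for t
  proof -
    define X where "X = (\<lambda>\<omega>. (ereal (l1_norm (Z \<omega>) / b t), Z \<omega> /\<^sub>R l1_norm (Z \<omega>)))"
    have X [measurable]: "X \<in> M \<rightarrow>\<^sub>M borel"
      unfolding X_def borel_prod[symmetric] by measurable
    \<comment> \<open>Restricting to \<open>polar_space\<close> loses nothing:
      \<open>X \<omega>\<close> leaves it only if \<open>Z \<omega> = 0\<close>, and then the radius
      is \<open>0\<close> and the cutoff vanishes.\<close>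
    have vanish: "indicator polar_space (X \<omega>) *\<^sub>R f (X \<omega>) = f (X \<omega>)" for \<omega>
    proof (cases "Z \<omega> = 0")
      case True
      then have "f (X \<omega>) = 0"
        unfolding f_def X_def using ramp_bounds(3)[OF \<delta>, of 0] \<delta> by (simp add: l1_norm_def zero_ereal_def)
      then show ?thesis by simp
    next
      case False
      then have "X \<omega> \<in> polar_space"
        unfolding X_def polar_space_def using l1_norm_normalized[OF False] t by simp
      then show ?thesis by simp
    qed
    have fr: "f \<in> borel_measurable (restrict_space (distr M borel X) polar_space)"
      by (rule measurable_restrict_space1) (simp add: fm)
    have "integral\<^sup>L (scaled_polar_law M Z b t) f
        = t * integral\<^sup>L (restrict_space (distr M borel X) polar_space) f"
      unfolding scaled_polar_law_def X_def[symmetric]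
      using t fr f_nonneg by (intro integral_scale_measure) auto
    also have "integral\<^sup>L (restrict_space (distr M borel X) polar_space) f
        = (\<integral>p. indicator polar_space p *\<^sub>R f p \<partial>distr M borel X)"
      by (subst integral_restrict_space) (auto simp: polar_space_borel)
    also have "\<dots> = (\<integral>\<omega>. indicator polar_space (X \<omega>) *\<^sub>R f (X \<omega>) \<partial>M)"
      using fm polar_space_borel by (intro integral_distr X borel_measurable_scaleR borel_measurable_indicator)
    also have "\<dots> = (\<integral>\<omega>. f (X \<omega>) \<partial>M)" by (simp only: vanish)
    finally show ?thesis unfolding polar_mean_def f_def X_def by simp
  qed
  show ?thesis
    using lim unfolding R
    by (rule Lim_transform_eventually) (use L in \<open>auto intro: eventually_mono[OF eventually_b_pos]\<close>)
qed

lemma polar_mean_integrable: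
  assumes "0 < \<delta>" "continuous_on UNIV h" "\<And>z. 0 \<le> h z" "\<And>z. h z \<le> 1"
  shows "integrable M (\<lambda>\<omega>. ramp \<delta> (ereal (l1_norm (Z \<omega>) / b t)) * h (Z \<omega> /\<^sub>R l1_norm (Z \<omega>)))"
proof (rule integrable_const_bound[where B = 1])
  have [measurable]: "h \<in> borel_measurable borel"
    using assms(2) by (rule borel_measurable_continuous_onI)
  show "(\<lambda>\<omega>. ramp \<delta> (ereal (l1_norm (Z \<omega>) / b t)) * h (Z \<omega> /\<^sub>R l1_norm (Z \<omega>))) \<in> borel_measurable M"
    by measurable
  show "AE \<omega> in M. norm (ramp \<delta> (ereal (l1_norm (Z \<omega>) / b t)) * h (Z \<omega> /\<^sub>R l1_norm (Z \<omega>))) \<le> 1"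
    using ramp_bounds(1,2)[OF assms(1)] assms(3,4)
    by (auto simp: abs_mult intro!: mult_le_one)
qed

text \<open>By uniqueness of limits the product of \<open>c\<close>, the radial integral and the
  angular integral is \<open>0\<close>. The first two factors are positive, so the integral of the
  nonnegative \<open>h\<close> vanishes.\<close>

lemma AE_eq_0_if_polar_mean_tendsto_0:
  assumes "0 < \<delta>" "continuous_on UNIV h" "\<And>z. 0 \<le> h z" "\<And>z. h z \<le> 1"
    and "(polar_mean \<delta> h \<longlongrightarrow> 0) at_top"
  shows "AE z in S. h z = 0"
proof -
  have "c * (\<integral>r. ramp \<delta> r \<partial>\<nu>) * (\<integral>z. h z \<partial>S) = 0"
    using tendsto_unique[OF _ polar_mean_tendsto[OF assms(1-3)] assms(5)] by simp
  moreover have "0 < (2 * \<delta>) powr (- \<alpha>)" using assms(1) by simp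
  then have "0 < (\<integral>r. ramp \<delta> r \<partial>\<nu>)"
    using ramp_integral_bounds(1)[OF tail assms(1)] by (rule less_le_trans)
  ultimately have "(\<integral>z. h z \<partial>S) = 0" using c_pos by simp
  moreover have "h \<in> borel_measurable S"
    using assms(2) by (intro borel_measurable_S borel_measurable_continuous_onI)
  then have "integrable S h"
    using assms(3,4) by (intro S.integrable_const_bound[where B = 1]) auto
  ultimately show ?thesis using assms(3) by (subst (asm) integral_nonneg_eq_0_iff_AE) auto
qed

text \<open>The truncated negative part of a coordinate is a test function whose polar mean is
  identically \<open>0\<close>, since normalizing preserves the signs of \<open>Z\<close>.\<close>

lemma AE_angular_nonneg: "AE z in S. \<forall>i. 0 \<le> z $ i"
proof -
  have "AE z in S. 0 \<le> z $ i" for i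
  proof -
    define h where "h = (\<lambda>z :: real ^ 'n. min 1 (max 0 (- z $ i)))"
    have "(\<integral>\<omega>. ramp 1 (ereal (l1_norm (Z \<omega>) / b t)) * h (Z \<omega> /\<^sub>R l1_norm (Z \<omega>)) \<partial>M) = 0" for t
    proof (rule integral_eq_zero_AE)
      show "AE \<omega> in M. ramp 1 (ereal (l1_norm (Z \<omega>) / b t)) * h (Z \<omega> /\<^sub>R l1_norm (Z \<omega>)) = 0"
        using Z_nonneg by eventually_elim (auto simp: h_def l1_norm_nonneg)
    qed
    then have "polar_mean 1 h = (\<lambda>t. 0)" by (auto simp: polar_mean_def)
    then have "AE z in S. h z = 0"
      by (intro AE_eq_0_if_polar_mean_tendsto_0[of 1])
        (auto simp: h_def intro!: continuous_intros)
    then show ?thesis by eventually_elim (auto simp: h_def min_def max_def split: if_splits)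
  qed
  then show ?thesis by (simp add: AE_all_countable)
qed

text \<open>If the radius exceeds \<open>b t\<close> and two angular coordinates exceed
  \<open>\<eta>\<close>, then the same coordinates of \<open>Z\<close> exceed
  \<open>\<eta> * b t\<close>. Hence a test function living on such angles has polar mean at most
  the joint tail.\<close>

lemma angular_null_if_tail_null:
  assumes "\<And>\<kappa>. 0 < \<kappa> \<Longrightarrow>
    ((\<lambda>t. t * measure M {\<omega> \<in> space M. Z \<omega> $ i / b t > \<kappa> \<and> Z \<omega> $ j / b t > \<kappa>}) \<longlongrightarrow> 0) at_top"
  shows "AE z in S. \<not> (0 < z $ i \<and> 0 < z $ j)"
proof -
  have "AE z in S. \<not> (\<eta> < z $ i \<and> \<eta> < z $ j)" if \<eta>: "0 < \<eta>" for \<eta>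
  proof -
    \<comment> \<open>Continuous, with values in \<open>[0, 1]\<close>, and positive exactly where
      both coordinates exceed \<open>\<eta>\<close>.\<close>
    define h where "h = (\<lambda>z :: real ^ 'n. min 1 (max 0 (min (z $ i) (z $ j) - \<eta>)))"
    have h: "continuous_on UNIV h" "\<And>z. 0 \<le> h z" "\<And>z. h z \<le> 1"
      by (auto simp: h_def intro!: continuous_intros)
    define E where "E = (\<lambda>t. {\<omega> \<in> space M. Z \<omega> $ i / b t > \<eta> \<and> Z \<omega> $ j / b t > \<eta>})"
    have E [measurable]: "E t \<in> sets M" for t unfolding E_def by measurable
    have "polar_mean 1 h t \<le> t * measure M (E t)" and "0 \<le> polar_mean 1 h t"
      if t: "0 < t" "0 < b t" for t
    proof -
      have le: "ramp 1 (ereal (l1_norm (Z \<omega>) / b t)) * h (Z \<omega> /\<^sub>R l1_norm (Z \<omega>)) \<le> indicator (E t) \<omega>"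
        if \<omega>: "\<omega> \<in> space M" for \<omega>
      proof (cases "\<omega> \<in> E t")
        case True
        then show ?thesis using ramp_bounds(1,2)[of 1] h(2,3) by (simp add: mult_le_one)
      next
        case False
        \<comment> \<open>If both factors were nonzero, the scaled radius would exceed
          \<open>1\<close> and both angular coordinates would exceed \<open>\<eta>\<close>, which
          puts \<open>\<omega>\<close> into \<open>E t\<close>.\<close>
        have "ramp 1 (ereal (l1_norm (Z \<omega>) / b t)) = 0 \<or> h (Z \<omega> /\<^sub>R l1_norm (Z \<omega>)) = 0"
        proof (rule ccontr)
          assume "\<not> ?thesis"
          then have r: "1 < l1_norm (Z \<omega>) / b t"
            and z: "\<eta> < (Z \<omega> /\<^sub>R l1_norm (Z \<omega>)) $ i" "\<eta> < (Z \<omega> /\<^sub>R l1_norm (Z \<omega>)) $ j"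
            using ramp_bounds(3)[of 1 "ereal (l1_norm (Z \<omega>) / b t)"]
            by (force simp: not_le[symmetric], auto simp: h_def min_def max_def split: if_splits)
          have N: "b t < l1_norm (Z \<omega>)" using r t by (simp add: field_simps)
          have "\<eta> < Z \<omega> $ k / b t" if "\<eta> < (Z \<omega> /\<^sub>R l1_norm (Z \<omega>)) $ k" for k
          proof -
            have "\<eta> * b t \<le> \<eta> * l1_norm (Z \<omega>)" using N \<eta> by simp
            also have "\<dots> < Z \<omega> $ k" using that N t by (simp add: field_simps)
            finally show ?thesis using t by (simp add: field_simps)
          qed
          then show False using z \<omega> False by (simp add: E_def)
        qed
        then show ?thesis by auto
      qed
      have "(\<integral>\<omega>. ramp 1 (ereal (l1_norm (Z \<omega>) / b t)) * h (Z \<omega> /\<^sub>R l1_norm (Z \<omega>)) \<partial>M)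
          \<le> (\<integral>\<omega>. indicator (E t) \<omega> \<partial>M)"
        using le by (intro integral_mono polar_mean_integrable h integrable_real_indicator)
          (auto simp: emeasure_eq_measure)
      then show "polar_mean 1 h t \<le> t * measure M (E t)"
        unfolding polar_mean_def using t by simp
      show "0 \<le> polar_mean 1 h t"
        unfolding polar_mean_def using t h(2) ramp_bounds(1)[of 1]
        by (intro mult_nonneg_nonneg integral_nonneg) auto
    qed
    then have bounds: "\<forall>\<^sub>F t in at_top. 0 \<le> polar_mean 1 h t"
      "\<forall>\<^sub>F t in at_top. polar_mean 1 h t \<le> t * measure M (E t)"
      by (auto intro: eventually_mono[OF eventually_b_pos])
    have "((\<lambda>t. t * measure M (E t)) \<longlongrightarrow> 0) at_top"
      using assms[OF \<eta>] by (simp add: E_def)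
    then have "(polar_mean 1 h \<longlongrightarrow> 0) at_top"
      by (rule tendsto_sandwich[OF bounds tendsto_const])
    then have "AE z in S. h z = 0"
      by (intro AE_eq_0_if_polar_mean_tendsto_0[of 1] h) auto
    then show ?thesis by eventually_elim (auto simp: h_def min_def max_def split: if_splits)
  qed
  \<comment> \<open>Countably many levels decreasing to \<open>0\<close> exhaust the event that both
    coordinates are positive.\<close>
  then have "AE z in S. \<forall>n. \<not> (inverse (real (Suc n)) < z $ i \<and> inverse (real (Suc n)) < z $ j)"
    by (subst AE_all_countable) auto
  then show ?thesis
  proof eventually_elim
    case (elim z)
    show ?case
    proof
      assume "0 < z $ i \<and> 0 < z $ j"
      then obtain n where "inverse (real (Suc n)) < min (z $ i) (z $ j)"
        using reals_Archimedean[of "min (z $ i) (z $ j)"] by auto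
      then show False using elim by auto
    qed
  qed
qed

text \<open>
  If both coordinates exceed \<open>\<kappa> b(t)\<close> while the radius is less than \<open>2 R b(t)\<close>, then both
  coordinates of the angle exceed \<open>\<kappa> / (2 R)\<close>; radii beyond \<open>R\<close> contribute at most \<open>c R\<^sup>-\<^sup>\<alpha>\<close> in the
  limit.
\<close>

lemma tail_null_if_angular_null:
  assumes null: "AE z in S. \<not> (0 < z $ i \<and> 0 < z $ j)" and \<kappa>: "0 < \<kappa>"
  shows "((\<lambda>t. t * measure M {\<omega> \<in> space M. Z \<omega> $ i / b t > \<kappa> \<and> Z \<omega> $ j / b t > \<kappa>}) \<longlongrightarrow> 0) at_top"
proof -
  define E where "E = (\<lambda>t. {\<omega> \<in> space M. Z \<omega> $ i / b t > \<kappa> \<and> Z \<omega> $ j / b t > \<kappa>})"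
  have E [measurable]: "E t \<in> sets M" for t unfolding E_def by measurable
  have "eventually (\<lambda>t. t * measure M (E t) < \<epsilon>) at_top" if \<epsilon>: "0 < \<epsilon>" for \<epsilon>
  proof -
    have "((\<lambda>R. c * R powr (- \<alpha>)) \<longlongrightarrow> c * 0) at_top"
      by (intro tendsto_mult tendsto_const tendsto_neg_powr filterlim_ident) (simp add: \<alpha>_pos)
    then have "eventually (\<lambda>R. c * R powr (- \<alpha>) < \<epsilon> \<and> 0 < R) at_top"
      using \<epsilon> by (intro eventually_conj eventually_gt_at_top order_tendstoD(2)) auto
    then obtain R where R: "c * R powr (- \<alpha>) < \<epsilon>" "0 < R"
      using eventually_happens'[OF trivial_limit_at_top_linorder] by blast
    \<comment> \<open>The slope \<open>2 * R / \<kappa>\<close> makes \<open>h\<close> equal to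
      \<open>1\<close> as soon as both coordinates reach \<open>\<kappa> / (2 * R)\<close>, while
      \<open>h\<close> still vanishes wherever one of them is nonpositive.\<close>
    define h where "h = (\<lambda>z :: real ^ 'n. min 1 (max 0 (min (z $ i) (z $ j)) * (2 * R / \<kappa>)))"
    have h: "continuous_on UNIV h" "\<And>z. 0 \<le> h z" "\<And>z. h z \<le> 1"
      using R \<kappa> by (auto simp: h_def intro!: continuous_intros)
    have "AE z in S. h z = 0"
      using null
    proof eventually_elim
      case (elim z)
      then have "max 0 (min (z $ i) (z $ j)) = 0" by (intro max_absorb1) (auto simp: min_le_iff_disj)
      then show ?case by (simp add: h_def)
    qed
    then have "(\<integral>z. h z \<partial>S) = 0" by (rule integral_eq_zero_AE)
    \<comment> \<open>The level \<open>\<kappa> / 2\<close> is chosen because the ramp then equals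
      \<open>1\<close> from radius \<open>\<kappa>\<close> on, and every point of \<open>E t\<close>
      has at least that scaled radius when \<open>b t\<close> is positive.\<close>
    then have "(polar_mean (\<kappa> / 2) h \<longlongrightarrow> 0) at_top"
      using polar_mean_tendsto[of "\<kappa> / 2" h] h \<kappa> by simp
    moreover have "(polar_mean R (\<lambda>_. 1) \<longlongrightarrow> c * (\<integral>r. ramp R r \<partial>\<nu>)) at_top"
      using polar_mean_tendsto[of R "\<lambda>_. 1"] R by (simp add: S.prob_space)
    ultimately have "((\<lambda>t. polar_mean (\<kappa> / 2) h t + polar_mean R (\<lambda>_. 1) t)
        \<longlongrightarrow> 0 + c * (\<integral>r. ramp R r \<partial>\<nu>)) at_top"
      by (rule tendsto_add)
    moreover have "c * (\<integral>r. ramp R r \<partial>\<nu>) < \<epsilon>"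
      using ramp_integral_bounds(2)[OF tail R(2)] c_pos R(1) by (smt (verit) mult_left_mono)
    ultimately have ev: "eventually (\<lambda>t. polar_mean (\<kappa> / 2) h t + polar_mean R (\<lambda>_. 1) t < \<epsilon>) at_top"
      by (intro order_tendstoD(2)) auto
    have "t * measure M (E t) \<le> polar_mean (\<kappa> / 2) h t + polar_mean R (\<lambda>_. 1) t"
      if t: "0 < t" "0 < b t" for t
    proof -
      let ?u = "\<lambda>\<omega>. ereal (l1_norm (Z \<omega>) / b t)" and ?z = "\<lambda>\<omega>. Z \<omega> /\<^sub>R l1_norm (Z \<omega>)"
      \<comment> \<open>On \<open>E t\<close> the first summand is \<open>1\<close> if the scaled
        radius is below \<open>2 * R\<close>; otherwise the second one is \<open>1\<close>.\<close>
      have le: "indicator (E t) \<omega> \<le> ramp (\<kappa> / 2) (?u \<omega>) * h (?z \<omega>) + ramp R (?u \<omega>) * 1" for \<omega>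
      proof (cases "\<omega> \<in> E t \<and> l1_norm (Z \<omega>) / b t < 2 * R")
        case True
        then have Zb: "\<kappa> * b t < Z \<omega> $ i" "\<kappa> * b t < Z \<omega> $ j" and N: "l1_norm (Z \<omega>) < 2 * R * b t"
          using t by (auto simp: E_def field_simps)
        have N_lower: "\<kappa> * b t < l1_norm (Z \<omega>)" using Zb(1) component_le_l1_norm[of "Z \<omega>" i] by simp
        have pos: "0 < l1_norm (Z \<omega>)" using N_lower \<kappa> t by (smt (verit) mult_pos_pos)
        have "ramp (\<kappa> / 2) (?u \<omega>) = 1"
          using N_lower t \<kappa> by (intro ramp_bounds(4)) (auto simp: field_simps)
        moreover have "h (?z \<omega>) = 1"
        proof -
          have "\<kappa> / (2 * R) \<le> ?z \<omega> $ k" if "\<kappa> * b t < Z \<omega> $ k" for k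
          proof -
            have "\<kappa> * l1_norm (Z \<omega>) \<le> \<kappa> * (2 * R * b t)" using N \<kappa> by simp
            also have "\<dots> = 2 * R * (\<kappa> * b t)" by simp
            also have "\<dots> \<le> 2 * R * (Z \<omega> $ k)" using that R by simp
            finally show ?thesis using pos R by (simp add: field_simps)
          qed
          then have "\<kappa> / (2 * R) \<le> max 0 (min (?z \<omega> $ i) (?z \<omega> $ j))" using Zb by (simp add: le_max_iff_disj)
          then have "\<kappa> / (2 * R) * (2 * R / \<kappa>) \<le> max 0 (min (?z \<omega> $ i) (?z \<omega> $ j)) * (2 * R / \<kappa>)"
            using R \<kappa> by (intro mult_right_mono) auto
          then show ?thesis unfolding h_def using R \<kappa> by simp
        qed
        ultimately show ?thesis using ramp_bounds(1)[OF R(2)] by (simp add: indicator_def)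
      next
        case False
        then show ?thesis
          using ramp_bounds(1,4)[OF R(2), of "?u \<omega>"] ramp_bounds(1)[of "\<kappa> / 2" "?u \<omega>"] h(2) \<kappa>
          by (auto simp: indicator_def)
      qed
      have int: "integrable M (\<lambda>\<omega>. ramp (\<kappa> / 2) (?u \<omega>) * h (?z \<omega>))"
        "integrable M (\<lambda>\<omega>. ramp R (?u \<omega>) * 1)"
        using \<kappa> R h by (intro polar_mean_integrable; simp)+
      have "measure M (E t) = (\<integral>\<omega>. indicator (E t) \<omega> \<partial>M)" by simp
      also have "\<dots> \<le> (\<integral>\<omega>. ramp (\<kappa> / 2) (?u \<omega>) * h (?z \<omega>) + ramp R (?u \<omega>) * 1 \<partial>M)"
        using le int by (intro integral_mono integrable_real_indicator Bochner_Integration.integrable_add)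
          (auto simp: emeasure_eq_measure)
      also have "\<dots> = (\<integral>\<omega>. ramp (\<kappa> / 2) (?u \<omega>) * h (?z \<omega>) \<partial>M) + (\<integral>\<omega>. ramp R (?u \<omega>) * 1 \<partial>M)"
        using int by (rule Bochner_Integration.integral_add)
      finally show ?thesis
        unfolding polar_mean_def distrib_left[symmetric] using t by simp
    qed
    then show ?thesis
      using eventually_elim2[OF ev eventually_b_pos] by (meson le_less_trans)
  qed
  moreover have "eventually (\<lambda>t. 0 \<le> t * measure M (E t)) at_top"
    using eventually_ge_at_top[of "0::real"] by eventually_elim simp
  ultimately have "((\<lambda>t. t * measure M (E t)) \<longlongrightarrow> 0) at_top"
    by (intro order_tendstoI) (auto elim: eventually_mono)
  then show ?thesis by (simp add: E_def)
qed

section \<open>Concentration on the two faces\<close>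

lemma face_measurable: "face A \<in> sets S"
proof -
  have "face A = (\<Inter>i\<in>- A. {z. z $ i = 0}) \<inter> l1_sphere" by (auto simp: face_def)
  moreover have "closed (\<Inter>i\<in>- A. {z :: real ^ 'n. z $ i = 0})"
    by (intro closed_INT ballI closed_Collect_eq continuous_intros)
  ultimately show ?thesis unfolding sets_S sets_restrict_space by (auto simp: image_iff)
qed

text \<open>The faces are disjoint, so their masses add up to that of the union, and total mass
  \<open>1\<close> is an almost sure statement. Almost sure nonnegativity turns nonzero coordinates
  into positive ones. An index outside both \<open>A1\<close> and \<open>A2\<close> may be paired
  with itself, which forces that coordinate to vanish.\<close>

lemma concentrates_on_faces_iff:
  assumes "A1 \<inter> A2 = {}"
  shows "concentrates_on_faces S A1 A2 \<longleftrightarrow> pairwise_asymp_independent M Z b (- A2) (- A1)"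
proof -
  \<comment> \<open>A common point would vanish in every coordinate, contradicting L1 norm
    \<open>1\<close>.\<close>
  have "face A1 \<inter> face A2 = {}"
  proof (rule ccontr)
    assume "face A1 \<inter> face A2 \<noteq> {}"
    then obtain z where z: "z \<in> face A1" "z \<in> face A2" by auto
    then have "z $ i = 0" for i using assms by (auto simp: face_def)
    then have "l1_norm z = 0" by (simp add: l1_norm_def)
    then show False using z by (simp add: face_def l1_sphere_def)
  qed
  then have "concentrates_on_faces S A1 A2 \<longleftrightarrow> measure S (face A1 \<union> face A2) = 1"
    unfolding concentrates_on_faces_def
    by (subst S.finite_measure_Union) (auto simp: face_measurable)
  also have "\<dots> \<longleftrightarrow> (AE z in S. z \<in> face A1 \<union> face A2)"
    by (intro S.prob_eq_1 sets.Un face_measurable)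
  also have "\<dots> \<longleftrightarrow> (AE z in S. \<forall>i\<in>- A2. \<forall>j\<in>- A1. \<not> (0 < z $ i \<and> 0 < z $ j))"
  proof -
    have "AE z in S. z \<in> face A1 \<union> face A2 \<longleftrightarrow> (\<forall>i\<in>- A2. \<forall>j\<in>- A1. \<not> (0 < z $ i \<and> 0 < z $ j))"
      using AE_angular_nonneg AE_space
    proof eventually_elim
      case (elim z)
      then have z: "z \<in> l1_sphere" "\<And>i. \<not> 0 < z $ i \<longleftrightarrow> z $ i = 0"
        by (auto simp: space_S not_less order_antisym)
      then show ?case by (auto simp: face_def)
    qed
    then show ?thesis by (rule eventually_subst)
  qed
  also have "\<dots> \<longleftrightarrow> (\<forall>i\<in>- A2. \<forall>j\<in>- A1. AE z in S. \<not> (0 < z $ i \<and> 0 < z $ j))"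
    by (simp only: AE_ball_countable[OF countable_finite[OF finite]])
  also have "\<dots> \<longleftrightarrow> pairwise_asymp_independent M Z b (- A2) (- A1)"
    unfolding pairwise_asymp_independent_def
    using angular_null_if_tail_null tail_null_if_angular_null by meson
  finally show ?thesis .
qed

section \<open>Reduction of general sets to pairs of coordinates\<close>

text \<open>A union bound over the finitely many pairs in \<open>I \<times> J\<close>; almost sure
  nonnegativity of \<open>Z\<close> removes the absolute values. It serves both the sets of
  \<open>asymp_independent\<close> and the boxes.\<close>

lemma null_if_pairwise:
  fixes E :: "real \<Rightarrow> 'a set"
  assumes "pairwise_asymp_independent M Z b I J" "0 < \<kappa>"
    and "\<And>t \<omega>. 0 < b t \<Longrightarrow> \<omega> \<in> E t \<Longrightarrow>
      \<omega> \<in> space M \<and> (\<exists>i\<in>I. \<kappa> < \<bar>Z \<omega> $ i / b t\<bar>) \<and> (\<exists>j\<in>J. \<kappa> < \<bar>Z \<omega> $ j / b t\<bar>)"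
  shows "((\<lambda>t. t * measure M (E t)) \<longlongrightarrow> 0) at_top"
proof -
  define D where "D = (\<lambda>t (i, j). {\<omega> \<in> space M. Z \<omega> $ i / b t > \<kappa> \<and> Z \<omega> $ j / b t > \<kappa>})"
  have D: "D t p \<in> sets M" for t p unfolding D_def by (cases p) simp
  have lim: "((\<lambda>t. \<Sum>p\<in>I \<times> J. t * measure M (D t p)) \<longlongrightarrow> 0) at_top"
    using assms(1,2) unfolding pairwise_asymp_independent_def D_def
    by (intro tendsto_null_sum) auto
  have "t * measure M (E t) \<le> (\<Sum>p\<in>I \<times> J. t * measure M (D t p))" if t: "0 < t" "0 < b t" for t
  proof (cases "E t \<in> sets M") \<comment> \<open>\<open>measure\<close> is \<open>0\<close> on non-measurable sets\<close>
    case True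
    have "AE \<omega> in M. \<omega> \<in> E t \<longrightarrow> \<omega> \<in> (\<Union>p\<in>I \<times> J. D t p)"
      using Z_nonneg
    proof eventually_elim
      case (elim \<omega>)
      then have "\<bar>Z \<omega> $ i / b t\<bar> = Z \<omega> $ i / b t" for i using t by simp
      then show ?case using assms(3)[OF t(2), of \<omega>] by (auto simp: D_def)
    qed
    then have "measure M (E t) \<le> measure M (\<Union>p\<in>I \<times> J. D t p)"
      using D by (intro finite_measure_mono_AE sets.finite_UN) auto
    also have "\<dots> \<le> (\<Sum>p\<in>I \<times> J. measure M (D t p))"
      using D by (intro finite_measure_subadditive_finite) auto
    finally show ?thesis using t by (simp add: sum_distrib_left[symmetric])
  next
    case False
    then show ?thesis using t by (simp add: measure_notin_sets sum_nonneg)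
  qed
  then have "\<forall>\<^sub>F t in at_top. 0 \<le> t * measure M (E t)"
    and "\<forall>\<^sub>F t in at_top. t * measure M (E t) \<le> (\<Sum>p\<in>I \<times> J. t * measure M (D t p))"
    by (auto intro: eventually_mono[OF eventually_b_pos])
  then show ?thesis
    by (rule tendsto_sandwich[OF _ _ tendsto_const lim])
qed

text \<open>One direction tests with half-spaces in a single coordinate, which are bounded away from
  \<open>0\<close>. For the other, a vector of norm at least \<open>\<epsilon>\<close> has a
  coordinate above a fixed fraction of \<open>\<epsilon>\<close>.\<close>

lemma asymp_independent_iff_pairwise:
  "asymp_independent M Z b A1 A2 \<longleftrightarrow> pairwise_asymp_independent M Z b A1 A2"
proof
  assume L: "asymp_independent M Z b A1 A2"
  show "pairwise_asymp_independent M Z b A1 A2"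
    unfolding pairwise_asymp_independent_def
  proof (intro ballI allI impI)
    fix i j and \<kappa> :: real
    assume ij: "i \<in> A1" "j \<in> A2" and \<kappa>: "0 < \<kappa>"
    define B where "B = (\<lambda>A k. {x \<in> space (\<Pi>\<^sub>M i\<in>A. (borel :: real measure)). \<kappa> < x (k :: 'n)})"
    have B: "B A k \<in> sets (\<Pi>\<^sub>M i\<in>A. borel)" "\<exists>\<epsilon>>0. \<forall>x\<in>B A k. \<epsilon> \<le> L2_set x A"
      if "k \<in> A" for A k
    proof -
      show "B A k \<in> sets (\<Pi>\<^sub>M i\<in>A. borel)" unfolding B_def using that by measurable
      have "\<kappa> \<le> L2_set x A" if "x \<in> B A k" for x
        using that member_le_L2_set[of A k x] \<open>k \<in> A\<close> by (auto simp: B_def)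
      then show "\<exists>\<epsilon>>0. \<forall>x\<in>B A k. \<epsilon> \<le> L2_set x A" using \<kappa> by blast
    qed
    have "(\<lambda>i\<in>A. Z \<omega> $ i / b t) \<in> B A k \<longleftrightarrow> \<kappa> < Z \<omega> $ k / b t" if "k \<in> A" for A k t \<omega>
      using that by (auto simp: B_def space_PiM)
    then show "((\<lambda>t. t * measure M {\<omega> \<in> space M. Z \<omega> $ i / b t > \<kappa> \<and> Z \<omega> $ j / b t > \<kappa>}) \<longlongrightarrow> 0) at_top"
      using L[unfolded asymp_independent_def, rule_format, OF B(1)[OF ij(1)] B(1)[OF ij(2)]]
        B(2)[OF ij(1)] B(2)[OF ij(2)] ij by simp
  qed
next
  assume R: "pairwise_asymp_independent M Z b A1 A2"
  \<comment> \<open>If all coordinates were at most \<open>\<kappa>\<close> in modulus, the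
    Euclidean norm, bounded by the L1 norm, would be at most
    \<open>CARD('n) * \<kappa> < \<epsilon>\<close>.\<close>
  have large: "\<exists>i\<in>A. \<kappa> < \<bar>x i\<bar>"
    if "\<epsilon> \<le> L2_set x A" "0 < \<kappa>" "real CARD('n) * \<kappa> < \<epsilon>" for \<epsilon> \<kappa> and x :: "'n \<Rightarrow> real" and A
  proof (rule ccontr)
    assume "\<not> ?thesis"
    then have "(\<Sum>i\<in>A. \<bar>x i\<bar>) \<le> real (card A) * \<kappa>" by (intro sum_bounded_above) auto
    also have "\<dots> \<le> real CARD('n) * \<kappa>"
      using that(2) by (intro mult_right_mono) (auto intro: card_mono)
    finally show False using L2_set_le_sum_abs[of x A] that by simp
  qed
  show "asymp_independent M Z b A1 A2"
    unfolding asymp_independent_def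
  proof (intro ballI impI, elim conjE exE)
    fix B1 B2 :: "('n \<Rightarrow> real) set" and \<epsilon>1 \<epsilon>2 :: real
    assume \<epsilon>: "0 < \<epsilon>1" "\<forall>x\<in>B1. \<epsilon>1 \<le> L2_set x A1" "0 < \<epsilon>2" "\<forall>x\<in>B2. \<epsilon>2 \<le> L2_set x A2"
    \<comment> \<open>One level serves both sets; the factor \<open>2\<close> gives the strict
      inequalities that \<open>large\<close> asks for.\<close>
    define \<kappa> where "\<kappa> = min \<epsilon>1 \<epsilon>2 / (2 * real CARD('n))"
    have \<kappa>: "0 < \<kappa>" "real CARD('n) * \<kappa> < \<epsilon>1" "real CARD('n) * \<kappa> < \<epsilon>2"
      using \<epsilon> by (auto simp: \<kappa>_def)
    show "((\<lambda>t. t * measure M {\<omega> \<in> space M.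
        (\<lambda>i\<in>A1. Z \<omega> $ i / b t) \<in> B1 \<and> (\<lambda>i\<in>A2. Z \<omega> $ i / b t) \<in> B2}) \<longlongrightarrow> 0) at_top"
    proof (rule null_if_pairwise[OF R \<kappa>(1)], intro conjI)
      fix t \<omega>
      assume "\<omega> \<in> {\<omega> \<in> space M. (\<lambda>i\<in>A1. Z \<omega> $ i / b t) \<in> B1 \<and> (\<lambda>i\<in>A2. Z \<omega> $ i / b t) \<in> B2}"
      then have "\<omega> \<in> space M" and "\<epsilon>1 \<le> L2_set (\<lambda>i\<in>A1. Z \<omega> $ i / b t) A1"
        and "\<epsilon>2 \<le> L2_set (\<lambda>i\<in>A2. Z \<omega> $ i / b t) A2"
        using \<epsilon> by auto
      then show "\<omega> \<in> space M" "\<exists>i\<in>A1. \<kappa> < \<bar>Z \<omega> $ i / b t\<bar>" "\<exists>j\<in>A2. \<kappa> < \<bar>Z \<omega> $ j / b t\<bar>"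
        using large[OF _ \<kappa>(1,2)] large[OF _ \<kappa>(1,3)] by fastforce+
    qed
  qed
qed

text \<open>A box free on \<open>A2\<close> can be bounded away from \<open>0\<close> only through
  coordinates outside \<open>A2\<close>, including those outside \<open>A1\<close> as well. This is
  why the pairs range over \<open>- A2\<close> and \<open>- A1\<close> instead of \<open>A1\<close>
  and \<open>A2\<close>.\<close>

lemma asymp_null_on_boxes_iff_pairwise:
  "asymp_null_on_boxes M Z b A1 A2 \<longleftrightarrow> pairwise_asymp_independent M Z b (- A2) (- A1)"
proof
  assume L: "asymp_null_on_boxes M Z b A1 A2"
  show "pairwise_asymp_independent M Z b (- A2) (- A1)"
    unfolding pairwise_asymp_independent_def
  proof (intro ballI allI impI)
    fix i j and \<kappa> :: real
    assume ij: "i \<in> - A2" "j \<in> - A1" and \<kappa>: "0 < \<kappa>"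
    define B where "B = (\<lambda>k. {z :: real ^ 'n. \<kappa> < z $ k})"
    have B: "B k \<in> sets borel" "bounded_away_from_0 (B k)" for k
    proof -
      show "B k \<in> sets borel" unfolding B_def
        by (rule borel_open) (rule open_halfspace_component_gt_cart)
      have "\<kappa> \<le> dist z 0" if "z \<in> B k" for z
        using that component_le_norm_cart[of z k] by (simp add: B_def)
      then show "bounded_away_from_0 (B k)" unfolding bounded_away_from_0_def using \<kappa> by blast
    qed
    \<comment> \<open>A half-space in coordinate \<open>k\<close> is a box whose only constrained
      factor is the one at \<open>k\<close>.\<close>
    have box: "box_free_on A (B k)" if "k \<notin> A" for A k
      unfolding box_free_on_def
      by (rule exI[of _ "\<lambda>l. if l = k then {\<kappa><..} else UNIV"]) (use that in \<open>auto simp: B_def\<close>)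
    have "{\<omega> \<in> space M. Z \<omega> /\<^sub>R b t \<in> B i \<inter> B j}
        = {\<omega> \<in> space M. Z \<omega> $ i / b t > \<kappa> \<and> Z \<omega> $ j / b t > \<kappa>}" for t
      by (auto simp: B_def field_simps)
    then show "((\<lambda>t. t * measure M {\<omega> \<in> space M. Z \<omega> $ i / b t > \<kappa> \<and> Z \<omega> $ j / b t > \<kappa>}) \<longlongrightarrow> 0) at_top"
      using L[unfolded asymp_null_on_boxes_def, rule_format, OF B(1)[of i] B(1)[of j]]
        B(2) box ij by simp
  qed
next
  assume R: "pairwise_asymp_independent M Z b (- A2) (- A1)"
  have large: "\<exists>i\<in>- A. \<kappa> < \<bar>z $ i\<bar>"
    if "box_free_on A B" "z \<in> B" "\<And>y. y \<in> B \<Longrightarrow> \<epsilon> \<le> dist y 0" "0 < \<kappa>" "real CARD('n) * \<kappa> < \<epsilon>"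
    for \<epsilon> \<kappa> and z :: "real ^ 'n" and A B
  proof (rule ccontr)
    assume small: "\<not> ?thesis"
    \<comment> \<open>Zeroing the free coordinates stays inside the box.\<close>
    define y :: "real ^ 'n" where "y = (\<chi> i. if i \<in> A then 0 else z $ i)"
    have "y \<in> B" using that(1,2) by (auto simp: box_free_on_def y_def)
    moreover have "(\<Sum>i\<in>UNIV. \<bar>y $ i\<bar>) \<le> real CARD('n) * \<kappa>"
      using small that(4) by (intro sum_bounded_above) (auto simp: y_def not_less)
    ultimately show False using norm_le_l1_cart[of y] that(3)[of y] that(5) by simp
  qed
  show "asymp_null_on_boxes M Z b A1 A2"
    unfolding asymp_null_on_boxes_def
  proof (intro ballI impI, elim conjE)
    fix B1 B2 :: "(real ^ 'n) set"
    assume B: "box_free_on A2 B1" "box_free_on A1 B2"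
      and "bounded_away_from_0 B1" "bounded_away_from_0 B2"
    then obtain \<epsilon>1 \<epsilon>2 where \<epsilon>: "0 < \<epsilon>1" "\<And>z. z \<in> B1 \<Longrightarrow> \<epsilon>1 \<le> dist z 0"
      "0 < \<epsilon>2" "\<And>z. z \<in> B2 \<Longrightarrow> \<epsilon>2 \<le> dist z 0"
      unfolding bounded_away_from_0_def by metis
    define \<kappa> where "\<kappa> = min \<epsilon>1 \<epsilon>2 / (2 * real CARD('n))"
    have \<kappa>: "0 < \<kappa>" "real CARD('n) * \<kappa> < \<epsilon>1" "real CARD('n) * \<kappa> < \<epsilon>2"
      using \<epsilon>(1,3) by (auto simp: \<kappa>_def)
    show "((\<lambda>t. t * measure M {\<omega> \<in> space M. Z \<omega> /\<^sub>R b t \<in> B1 \<inter> B2}) \<longlongrightarrow> 0) at_top"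
    proof (rule null_if_pairwise[OF R \<kappa>(1)], intro conjI)
      fix t \<omega>
      assume *: "\<omega> \<in> {\<omega> \<in> space M. Z \<omega> /\<^sub>R b t \<in> B1 \<inter> B2}"
      then show "\<omega> \<in> space M" by simp
      show "\<exists>i\<in>- A2. \<kappa> < \<bar>Z \<omega> $ i / b t\<bar>" "\<exists>j\<in>- A1. \<kappa> < \<bar>Z \<omega> $ j / b t\<bar>"
        using * large[OF B(1) _ \<epsilon>(2) \<kappa>(1,2), of "Z \<omega> /\<^sub>R b t"]
          large[OF B(2) _ \<epsilon>(4) \<kappa>(1,3), of "Z \<omega> /\<^sub>R b t"]
        by (auto simp: divide_inverse mult.commute)
    qed
  qed
qed

end

section \<open>Assembling the equivalences\<close>

theorem theorem3p1:
  fixes M :: "'a measure" and Z :: "'a \<Rightarrow> real ^ 'n" and b :: "real \<Rightarrow> real"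
    and S :: "(real ^ 'n) measure" and A1 A2 :: "'n set"
  assumes "CARD('n) \<ge> 2"
    and "prob_space M" and "Z \<in> borel_measurable M"
    and "AE \<omega> in M. \<forall>i. 0 \<le> Z \<omega> $ i"
    and "regularly_varying M Z b" and "angular_measure M Z b S"
    and "A1 \<inter> A2 = {}" and "card A1 \<ge> 1" and "card A2 \<ge> 1"
  shows
    "(A1 \<union> A2 = UNIV \<longrightarrow>
        (asymp_independent M Z b A1 A2 \<longleftrightarrow> asymp_null_on_boxes M Z b A1 A2) \<and>
        (asymp_null_on_boxes M Z b A1 A2 \<longleftrightarrow> pairwise_asymp_independent M Z b A1 A2) \<and>
        (pairwise_asymp_independent M Z b A1 A2 \<longleftrightarrow> concentrates_on_faces S A1 A2)) \<and>
     (asymp_independent M Z b A1 A2 \<longleftrightarrow> pairwise_asymp_independent M Z b A1 A2) \<and>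
     (asymp_null_on_boxes M Z b A1 A2 \<longleftrightarrow> concentrates_on_faces S A1 A2) \<and>
     (asymp_null_on_boxes M Z b A1 A2 \<longrightarrow> asymp_independent M Z b A1 A2)"
proof -
  obtain c \<alpha> \<nu> where S: "prob_space S" "sets S = sets (restrict_space borel l1_sphere)"
    and lim: "0 < c" "0 < \<alpha>" "power_tail_measure \<alpha> \<nu>"
      "vaguely_tendsto polar_space (scaled_polar_law M Z b) (scale_measure (ennreal c) (\<nu> \<Otimes>\<^sub>M S))"
    using assms(6) unfolding angular_measure_def by blast
  interpret M: prob_space M by fact
  interpret S: prob_space S by fact
  interpret polar_convergence M S Z b c \<alpha> \<nu>
    using assms(3-5) S(2) lim by unfold_locales (auto simp: regularly_varying_def)
  \<comment> \<open>All four conditions are now pairwise conditions. Disjointness makes the pairs of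
    conditions 1 and 3 a superset of those of conditions 0 and 2; when \<open>A1\<close> and
    \<open>A2\<close> cover all indices, the two families of pairs coincide.\<close>
  have "A1 \<subseteq> - A2" "A2 \<subseteq> - A1" using assms(7) by auto
  then have "pairwise_asymp_independent M Z b (- A2) (- A1) \<longrightarrow> pairwise_asymp_independent M Z b A1 A2"
    unfolding pairwise_asymp_independent_def by blast
  moreover have "- A2 = A1" "- A1 = A2" if "A1 \<union> A2 = UNIV" using that assms(7) by auto
  ultimately show ?thesis
    unfolding asymp_independent_iff_pairwise asymp_null_on_boxes_iff_pairwise
      concentrates_on_faces_iff[OF assms(7)] by auto
qed

end
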